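(* Let $\mathcal{B}$ be a ternary relation on a finite set. Then $\mathcal{B}$ is an abstract causal betweenness if and only if $\mathcal{B}$ is a betweenness and the directed graph $G(\mathcal{B})$ contains no directed cycle.
   Context: A finite probability space is an ordered pair $(S,p)$ where $S$ is a finite set and $p:S\to[0,1]$ is a function with $\sum_{s\in S}p(s)=1$. Subsets of $S$ are called events; for events $A,B$, write $AB=A\cap B$, $P(A)=\sum_{s\in A}p(s)$, and, when $P(B)>0$, $P(A|B)=P(AB)/P(B)$. An event $B$ is causally between events $A$ and $C$ if all of the following hold: (1) $P(AC)>P(A)\cdot P(C)$; (2) $P(C|B)>P(C|A)$; (3) $P(A|B)>P(A|C)$; (4) $P(AC|B)=P(A|B)\cdot P(C|B)$; (5) $P(B-A)>0$ and $P(B-C)>0$ (where $-$ denotes set difference). (The conditional probabilities are well defined, since (1) guarantees $P(A)>0$ and $P(C)>0$, and (5) guarantees $P(B)>0$.) Given a set $X$ of events in a finite probability space, $\mathcal{CB}(X)$ denotes the ternary relation on the ground set $X$ consisting of all ordered triples $(A,B,C)$ of events in $X$ satisfying (1)--(5). A ternary relation $\mathcal{B}$ on a finite ground set is an abstract causal betweenness if and only if there is a set $X$ of events in a finite probability space such that $\mathcal{CB}(X)$ is isomorphic to $\mathcal{B}$ (i.e. there is a bijection between the ground set of $\mathcal{B}$ and $X$ under which a triple is in $\mathcal{B}$ exactly when its image is in $\mathcal{CB}(X)$). A ternary relation $\mathcal{B}$ is a betweenness if for all $A,B,C$ in its ground set: $(A,B,C)\in\mathcal{B}$ implies that $A,B,C$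 are all distinct; $(A,B,C)\in\mathcal{B}$ implies $(C,B,A)\in\mathcal{B}$; and $(A,B,C)\in\mathcal{B}$ implies $(C,A,B)\notin\mathcal{B}$. For a betweenness $\mathcal{B}$ on a ground set $X$, $G(\mathcal{B})$ is the directed graph whose vertices are all two-point subsets of $X$ and whose edges are all ordered pairs $(\{A,B\},\{A,C\})$ such that $(A,B,C)\in\mathcal{B}$. *)

theory Defs
  imports Complex_Main "Graph_Theory.Pair_Digraph"
begin

definition finite_prob_space :: "'s set \<Rightarrow> ('s \<Rightarrow> real) \<Rightarrow> bool" where
  "finite_prob_space S p \<longleftrightarrow> finite S \<and> (\<forall>s\<in>S. 0 \<le> p s \<and> p s \<le> 1) \<and> (\<Sum>s\<in>S. p s) = 1"

definition event_prob :: "('s \<Rightarrow> real) \<Rightarrow> 's set \<Rightarrow> real" where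
  "event_prob p A = (\<Sum>s\<in>A. p s)"

(* Equals 0 by convention if B has probability 0; this case never arises in causally_between,
   where the first and last conditions force A, B and C to have positive probability. *)
definition event_cond_prob :: "('s \<Rightarrow> real) \<Rightarrow> 's set \<Rightarrow> 's set \<Rightarrow> real" where
  "event_cond_prob p A B = event_prob p (A \<inter> B) / event_prob p B"

(* The middle argument B lies between A and C. *)
definition causally_between :: "('s \<Rightarrow> real) \<Rightarrow> 's set \<Rightarrow> 's set \<Rightarrow> 's set \<Rightarrow> bool" where
  "causally_between p A B C \<longleftrightarrow>
     event_prob p (A \<inter> C) > event_prob p A * event_prob p C \<and>
     event_cond_prob p C B > event_cond_prob p C A \<and>
     event_cond_prob p A B > event_cond_prob p A C \<and>
     event_cond_prob p (A \<inter> C) B = event_cond_prob p A B * event_cond_prob p C B \<and>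
     event_prob p (B - A) > 0 \<and> event_prob p (B - C) > 0"

definition CB :: "('s \<Rightarrow> real) \<Rightarrow> 's set set \<Rightarrow> ('s set \<times> 's set \<times> 's set) set" where
  "CB p X = {(A, B, C). A \<in> X \<and> B \<in> X \<and> C \<in> X \<and> causally_between p A B C}"

definition ternary_isomorphic ::
    "'a set \<Rightarrow> ('a \<times> 'a \<times> 'a) set \<Rightarrow> 'b set \<Rightarrow> ('b \<times> 'b \<times> 'b) set \<Rightarrow> bool" where
  "ternary_isomorphic V R W Q \<longleftrightarrow>
     (\<exists>f. bij_betw f V W \<and>
        (\<forall>a\<in>V. \<forall>b\<in>V. \<forall>c\<in>V. (a, b, c) \<in> R \<longleftrightarrow> (f a, f b, f c) \<in> Q))"

(* HOL cannot quantify over the type of sample points, so they are taken to be natural numbers.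
   Lemma abstract_causal_betweennessI below shows that this loses no generality:
   a representation by events over any sample type yields one over the naturals. *)
definition abstract_causal_betweenness :: "'a set \<Rightarrow> ('a \<times> 'a \<times> 'a) set \<Rightarrow> bool" where
  "abstract_causal_betweenness V R \<longleftrightarrow>
     (\<exists>(S :: nat set) p X. finite_prob_space S p \<and> X \<subseteq> Pow S \<and>
        ternary_isomorphic V R X (CB p X))"

definition betweenness :: "'a set \<Rightarrow> ('a \<times> 'a \<times> 'a) set \<Rightarrow> bool" where
  "betweenness V R \<longleftrightarrow>
     (\<forall>a\<in>V. \<forall>b\<in>V. \<forall>c\<in>V. (a, b, c) \<in> R \<longrightarrow>
        (a \<noteq> b \<and> b \<noteq> c \<and> a \<noteq> c) \<and> (c, b, a) \<in> R \<and> (c, a, b) \<notin> R)"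

definition betweenness_digraph ::
    "'a set \<Rightarrow> ('a \<times> 'a \<times> 'a) set \<Rightarrow> 'a set pair_pre_digraph" where
  "betweenness_digraph V R =
     \<lparr> pverts = {e. e \<subseteq> V \<and> card e = 2},
       parcs = {({a, b}, {a, c}) | a b c. (a, b, c) \<in> R} \<rparr>"

(* Cycles in the library sense are closed walks with at least one arc and
   without repeated vertices. *)
definition has_directed_cycle :: "'v pair_pre_digraph \<Rightarrow> bool" where
  "has_directed_cycle G \<longleftrightarrow> (\<exists>c. pre_digraph.cycle (with_proj G) c)"

lemma abstract_causal_betweennessI:
  fixes S :: "'s set" and p :: "'s \<Rightarrow> real" and X :: "'s set set"
    and V :: "'a set" and R :: "('a \<times> 'a \<times> 'a) set"
  assumes S: "finite_prob_space S p" and X: "X \<subseteq> Pow S"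
    and iso: "ternary_isomorphic V R X (CB p X)"
  shows "abstract_causal_betweenness V R"
proof -
  have "finite S" using S by (simp add: finite_prob_space_def)
  then obtain g :: "'s \<Rightarrow> nat" where g: "inj_on g S"
    using finite_imp_inj_to_nat_seg[of S] by meson
  define q where "q = p \<circ> inv_into S g"
  define Y where "Y = image g ` X"
  have qg: "q (g s) = p s" if "s \<in> S" for s
    using g that by (simp add: q_def)
  have prob: "event_prob q (g ` A) = event_prob p A" if "A \<subseteq> S" for A
  proof -
    have "inj_on g A" using g that by (rule inj_on_subset)
    then have "sum q (g ` A) = (\<Sum>s\<in>A. q (g s))" by (simp add: sum.reindex)
    also have "\<dots> = sum p A" using that qg by (intro sum.cong) auto
    finally show ?thesis by (simp add: event_prob_def)
  qed
  have int: "g ` A \<inter> g ` B = g ` (A \<inter> B)" if "A \<subseteq> S" "B \<subseteq> S" for A B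
    using inj_on_image_Int[OF g that] by simp
  have diff: "g ` A - g ` B = g ` (A - B)" if "A \<subseteq> S" "B \<subseteq> S" for A B
    using inj_on_image_set_diff[OF g, of A B] that by auto
  have cond: "event_cond_prob q (g ` A) (g ` B) = event_cond_prob p A B"
    if "A \<subseteq> S" "B \<subseteq> S" for A B
  proof -
    have "A \<inter> B \<subseteq> S" using that by blast
    then show ?thesis using that by (simp add: event_cond_prob_def int prob)
  qed
  have cb: "causally_between q (g ` A) (g ` B) (g ` C) \<longleftrightarrow> causally_between p A B C"
    if "A \<subseteq> S" "B \<subseteq> S" "C \<subseteq> S" for A B C
  proof -
    have "A \<inter> C \<subseteq> S" "B - A \<subseteq> S" "B - C \<subseteq> S" using that by auto
    then show ?thesis using that by (simp add: causally_between_def int diff cond prob)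
  qed
  have inj: "inj_on (image g) X"
    using inj_on_subset[OF inj_on_image_Pow[OF g] X] .
  obtain f where f: "bij_betw f V X"
    and fR: "\<And>a b c. \<lbrakk>a \<in> V; b \<in> V; c \<in> V\<rbrakk> \<Longrightarrow> (a, b, c) \<in> R \<longleftrightarrow> (f a, f b, f c) \<in> CB p X"
    using iso unfolding ternary_isomorphic_def by blast
  have "bij_betw (image g \<circ> f) V Y"
    by (rule bij_betw_trans[OF f]) (simp add: Y_def bij_betw_def inj)
  moreover have "(a, b, c) \<in> R \<longleftrightarrow> ((image g \<circ> f) a, (image g \<circ> f) b, (image g \<circ> f) c) \<in> CB q Y"
    if "a \<in> V" "b \<in> V" "c \<in> V" for a b c
  proof -
    have *: "f a \<in> X" "f b \<in> X" "f c \<in> X" using f that by (auto simp: bij_betw_def)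
    then have "f a \<subseteq> S" "f b \<subseteq> S" "f c \<subseteq> S" using X by auto
    then show ?thesis using * fR[OF that] by (simp add: CB_def Y_def cb)
  qed
  ultimately have "ternary_isomorphic V R Y (CB q Y)"
    unfolding ternary_isomorphic_def by blast
  moreover have "finite_prob_space (g ` S) q"
    using S prob[of S] by (auto simp: finite_prob_space_def event_prob_def qg)
  moreover have "Y \<subseteq> Pow (g ` S)" using X by (auto simp: Y_def)
  ultimately show ?thesis unfolding abstract_causal_betweenness_def by blast
qed

end

theory Submission
  imports Defs
begin

text \<open>
  If B is causally between A and C, then (2) and (3) say that the correlation
  P(AC) / (P(A) P(C)) is smaller than that of A, B and that of B, C. So the correlation strictly
  decreases along the arcs of the digraph, which excludes cycles.

  Conversely, take the subsets of V as sample points and E(a) = {x. a in x} as events. A density on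
  them with small nonconstant Walsh coefficients h satisfies
  P(E(a) E(b)) = (1 + h{a,b}) / 4, and likewise for triples. Let h{a,b} = w{a,b} be small, positive,
  decreasing along arcs, and with every product of two values below every value. Then (4) for b
  between a and c becomes h{a,b,c} = w{a,b} w{b,c} - w{a,c}. This value is
  prescribed on triples with a middle point; on the others h{a,b,c} = 0 violates (4)
  for each choice of the middle.
\<close>

section \<open>Cycles and acyclic relations\<close>

lemma pcas_imp_trancl:
  "\<lbrakk>pcas u es v; set es \<subseteq> r; es \<noteq> []\<rbrakk> \<Longrightarrow> (u, v) \<in> r\<^sup>+"
proof (induction es arbitrary: u)
  case (Cons e es)
  then have e: "(u, snd e) \<in> r" by (cases e) auto
  show ?case
  proof (cases "es = []")
    case True
    with Cons.prems e show ?thesis by auto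
  next
    case False
    with Cons have "(snd e, v) \<in> r\<^sup>+" by simp
    with e show ?thesis by (rule trancl_into_trancl2)
  qed
qed simp

text \<open>Cutting a closed walk at its repeated vertices leaves a cycle in the library sense, so
  it suffices to find a closed walk with at least one arc, that is, a loop of the transitive
  closure.\<close>

lemma has_directed_cycle_iff:
  assumes "pair_wf_digraph G"
  shows "has_directed_cycle G \<longleftrightarrow> \<not> acyclic (parcs G)"
proof -
  interpret pair_wf_digraph G by fact
  have "\<not> acyclic (parcs G)" if "cycle es" for es
  proof -
    from that obtain u where "pcas u es u" "set es \<subseteq> parcs G" "es \<noteq> []"
      unfolding cycle_def awalk_def by auto
    then have "(u, u) \<in> (parcs G)\<^sup>+" by (rule pcas_imp_trancl)
    then show ?thesis by (auto simp: acyclic_def)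
  qed
  moreover have "\<exists>es. cycle es" if "\<not> acyclic (parcs G)"
  proof -
    from that obtain u where "(u, u) \<in> (parcs G)\<^sup>+" by (auto simp: acyclic_def)
    then have "\<exists>es. awalk u es u \<and> es \<noteq> []" by (simp add: reachable1_awalk)
    then have "\<exists>es. closed_w es" unfolding closed_w_def by auto
    then show ?thesis using closed_w_imp_cycle by blast
  qed
  ultimately show ?thesis unfolding has_directed_cycle_def by blast
qed

lemma acyclic_if_decreasing:
  fixes f :: "'v \<Rightarrow> 'w::order"
  assumes "\<And>x y. (x, y) \<in> r \<Longrightarrow> f y < f x"
  shows "acyclic r"
proof -
  have "f y < f x" if "(x, y) \<in> r\<^sup>+" for x y
    using that by (induction rule: trancl_induct) (auto dest: assms)
  then show ?thesis unfolding acyclic_def by blast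
qed

text \<open>The function counts the points reachable by at least one step. It is scaled into the
  unit interval so that the weights built from it later stay within a factor two of each
  other.\<close>

lemma acyclic_imp_decreasing:
  assumes "finite r" and "acyclic r"
  obtains f :: "'v \<Rightarrow> real"
  where "\<And>x. 0 \<le> f x" "\<And>x. f x \<le> 1" "\<And>x y. (x, y) \<in> r \<Longrightarrow> f y < f x"
proof
  \<comment> \<open>The successor keeps the denominator positive when \<open>r\<close> is
    empty.\<close>
  define N where "N = Suc (card (Range r))"
  define f where "f x = real (card (r\<^sup>+ `` {x})) / real N" for x
  have fin: "finite (Range r)" using assms(1) by (rule finite_Range)
  have sub: "r\<^sup>+ `` {x} \<subseteq> Range r" for x
    using trancl_range[of r] by blast
  show "0 \<le> f x" for x by (simp add: f_def)
  have "card (r\<^sup>+ `` {x}) \<le> N" for x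
    using card_mono[OF fin sub[of x]] by (simp add: N_def)
  moreover have "0 < N" by (simp add: N_def)
  ultimately show "f x \<le> 1" for x by (simp add: f_def)
  show "f y < f x" if "(x, y) \<in> r" for x y
  proof -
    \<comment> \<open>Strictness comes from acyclicity: \<open>y\<close> is reachable from
      \<open>x\<close> but not from itself.\<close>
    have "y \<notin> r\<^sup>+ `` {y}" using assms(2) by (auto simp: acyclic_def)
    moreover have "y \<in> r\<^sup>+ `` {x}" using that by auto
    moreover have "r\<^sup>+ `` {y} \<subseteq> r\<^sup>+ `` {x}"
      using that by (auto intro: trancl_into_trancl2)
    ultimately have "r\<^sup>+ `` {y} \<subset> r\<^sup>+ `` {x}" by blast
    then have "card (r\<^sup>+ `` {y}) < card (r\<^sup>+ `` {x})"
      using finite_subset[OF sub fin] by (intro psubset_card_mono)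
    then show ?thesis by (simp add: f_def N_def divide_strict_right_mono)
  qed
qed

section \<open>Causal betweenness decreases correlation\<close>

text \<open>This is the ratio of P(AB) to its value under independence (the lift), not the
  correlation coefficient.\<close>

definition event_corr :: "('s \<Rightarrow> real) \<Rightarrow> 's set \<Rightarrow> 's set \<Rightarrow> real" where
  "event_corr p A B = event_prob p (A \<inter> B) / (event_prob p A * event_prob p B)"

lemma causally_between_sym: "causally_between p A B C \<Longrightarrow> causally_between p C B A"
  by (simp add: causally_between_def Int_commute mult.commute)

lemma event_prob_mono:
  assumes "finite_prob_space S p" and "A \<subseteq> B" and "B \<subseteq> S"
  shows "event_prob p A \<le> event_prob p B"
  using assms unfolding event_prob_def finite_prob_space_def
  by (intro sum_mono2) (auto dest: finite_subset)

lemma event_prob_nonneg: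
  assumes "finite_prob_space S p" and "A \<subseteq> S"
  shows "0 \<le> event_prob p A"
  using event_prob_mono[OF assms(1) _ assms(2), of "{}"] by (simp add: event_prob_def)

lemma causally_between_pos:
  assumes S: "finite_prob_space S p" "A \<subseteq> S" "B \<subseteq> S" "C \<subseteq> S"
    and cb: "causally_between p A B C"
  shows "0 < event_prob p A" "0 < event_prob p B" "0 < event_prob p C"
proof -
  have AC: "0 < event_prob p (A \<inter> C)"
    using cb event_prob_nonneg[OF S(1,2)] event_prob_nonneg[OF S(1,4)]
    unfolding causally_between_def by (smt (verit) mult_nonneg_nonneg)
  then show "0 < event_prob p A" using event_prob_mono[OF S(1) _ S(2), of "A \<inter> C"] by simp
  from AC show "0 < event_prob p C" using event_prob_mono[OF S(1) _ S(4), of "A \<inter> C"] by simp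
  have "0 < event_prob p (B - A)" using cb by (simp add: causally_between_def)
  then show "0 < event_prob p B" using event_prob_mono[OF S(1) _ S(3), of "B - A"] by auto
qed

text \<open>This is condition (3) divided by P(A).\<close>

lemma causally_between_corr_less:
  assumes S: "finite_prob_space S p" "A \<subseteq> S" "B \<subseteq> S" "C \<subseteq> S"
    and cb: "causally_between p A B C"
  shows "event_corr p A C < event_corr p A B"
proof -
  note pos = causally_between_pos[OF assms]
  have "event_prob p (A \<inter> C) / event_prob p C < event_prob p (A \<inter> B) / event_prob p B"
    using cb by (simp add: causally_between_def event_cond_prob_def)
  with pos show ?thesis by (simp add: event_corr_def field_simps)
qed

text \<open>Condition (5) separates B from A and from C. If A = C, then P(C|A) = 1, which P(C|B)
  cannot exceed. The triples (A,B,C) and (C,A,B) would order the correlations of C, A and of C, B in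
  opposite ways.\<close>

lemma causally_between_betweenness:
  assumes S: "finite_prob_space S p" "A \<subseteq> S" "B \<subseteq> S" "C \<subseteq> S"
    and cb: "causally_between p A B C"
  shows "A \<noteq> B" "B \<noteq> C" "A \<noteq> C" "\<not> causally_between p C A B"
proof -
  show "A \<noteq> B" "B \<noteq> C"
    using cb by (auto simp: causally_between_def event_prob_def)
  have less: "event_corr p C A < event_corr p C B"
    using causally_between_corr_less[OF S(1,4,3,2) causally_between_sym[OF cb]] .
  show "\<not> causally_between p C A B"
    using less causally_between_corr_less[OF S(1,4,2,3)] by fastforce
  show "A \<noteq> C"
  proof
    assume "A = C"
    moreover have "event_prob p (C \<inter> B) \<le> event_prob p B"
      using event_prob_mono[OF S(1) _ S(3)] by blast
    ultimately show False
      using cb causally_between_pos[OF assms]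
      by (simp add: causally_between_def event_cond_prob_def field_simps)
  qed
qed

section \<open>Prescribing the Walsh coefficients of a distribution\<close>

text \<open>The Walsh function of \<open>T\<close> multiplies signs over \<open>T\<close>: +1 for
  points of \<open>x\<close>, -1 for the others. The sum factors over the points of
  \<open>V\<close>, and a point of \<open>T\<close> outside \<open>U\<close> contributes 1 - 1 =
  0.\<close>

lemma sum_Walsh:
  assumes V: "finite V" and "U \<subseteq> V" and "T \<subseteq> V"
  shows "(\<Sum>x \<in> {x \<in> Pow V. U \<subseteq> x}. (-1) ^ card (T - x)) =
    (if T \<subseteq> U then 2 ^ (card V - card U) else (0::real))"
proof -
  \<comment> \<open>\<open>g a\<close> is the factor of a point left out of \<open>x\<close>: zero
    if \<open>U\<close> demands the point, otherwise its sign. Points of \<open>x\<close> have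
    factor 1.\<close>
  define g :: "'a \<Rightarrow> real" where "g a = (if a \<in> U then 0 else if a \<in> T then -1 else 1)" for a
  have g: "(\<Prod>a\<in>V - x. g a) = (if U \<subseteq> x then (-1) ^ card (T - x) else 0)" if "x \<subseteq> V" for x
  proof (cases "U \<subseteq> x")
    case True
    have "(\<Prod>a\<in>V - x. g a) = (\<Prod>a\<in>V - x. if a \<in> T then -1 else 1)"
      using True by (intro prod.cong) (auto simp: g_def)
    also have "\<dots> = (\<Prod>a\<in>(V - x) \<inter> T. -1)"
      using V by (subst prod.inter_restrict) auto
    also have "(V - x) \<inter> T = T - x" using assms by auto
    finally show ?thesis using True by simp
  next
    case False
    then obtain a where "a \<in> U" "a \<notin> x" by blast
    then have "a \<in> V - x" "g a = 0" using assms(2) by (auto simp: g_def)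
    then show ?thesis using False V by (auto intro!: prod_zero)
  qed
  have "(\<Sum>x \<in> {x \<in> Pow V. U \<subseteq> x}. (-1) ^ card (T - x)) = (\<Sum>x\<in>Pow V. \<Prod>a\<in>V - x. g a)"
    using V by (subst sum.inter_filter) (auto simp: g intro!: sum.cong)
  also have "\<dots> = (\<Prod>a\<in>V. 1 + g a)"
    using prod_add[OF V, of "\<lambda>_. 1" g] by simp
  also have "\<dots> = (if T \<subseteq> U then 2 ^ (card V - card U) else 0)"
  proof (cases "T \<subseteq> U")
    case True
    have "(\<Prod>a\<in>V. 1 + g a) = (\<Prod>a\<in>V. if a \<in> V - U then 2 else 1)"
      using True by (intro prod.cong) (auto simp: g_def)
    also have "\<dots> = (\<Prod>a\<in>V \<inter> (V - U). 2)"
      using V by (subst prod.inter_restrict) auto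
    also have "\<dots> = 2 ^ (card V - card U)"
      using assms by (simp add: Int_absorb1 card_Diff_subset finite_subset[of U V])
    finally show ?thesis using True by simp
  next
    case False
    then obtain a where "a \<in> T" "a \<notin> U" by blast
    then have "a \<in> V" "1 + g a = 0" using assms(3) by (auto simp: g_def)
    then show ?thesis using False V by (auto intro!: prod_zero)
  qed
  finally show ?thesis .
qed

text \<open>Here \<open>h T\<close> is the expectation of the product of the signs over
  \<open>T\<close>. The indicator of containing \<open>U\<close> is the product over
  \<open>U\<close> of (1 + sign)/2, and expanding it gives the formula.\<close>

lemma ex_prob_Walsh:
  fixes h :: "'a set \<Rightarrow> real"
  assumes V: "finite V" and h0: "h {} = 1"
    and small: "\<And>T. \<lbrakk>T \<subseteq> V; T \<noteq> {}\<rbrakk> \<Longrightarrow> \<bar>h T\<bar> \<le> 1 / 2 ^ card V"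
  obtains p where "finite_prob_space (Pow V) p"
    and "\<And>U. U \<subseteq> V \<Longrightarrow> event_prob p {x \<in> Pow V. U \<subseteq> x} = (\<Sum>T\<in>Pow U. h T) / 2 ^ card U"
proof
  \<comment> \<open>The inverse Walsh transform of \<open>h\<close>.\<close>
  define p where "p x = (\<Sum>T\<in>Pow V. h T * (-1) ^ card (T - x)) / 2 ^ card V" for x
  show ev: "event_prob p {x \<in> Pow V. U \<subseteq> x} = (\<Sum>T\<in>Pow U. h T) / 2 ^ card U"
    if U: "U \<subseteq> V" for U
  proof -
    have "event_prob p {x \<in> Pow V. U \<subseteq> x} =
      (\<Sum>T\<in>Pow V. \<Sum>x\<in>{x \<in> Pow V. U \<subseteq> x}. h T * (-1) ^ card (T - x)) / 2 ^ card V"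
      unfolding event_prob_def p_def by (subst sum.swap) (simp add: sum_divide_distrib)
    also have "\<dots> = (\<Sum>T\<in>Pow V. h T * (if T \<subseteq> U then 2 ^ (card V - card U) else 0)) / 2 ^ card V"
      using sum_Walsh[OF V U] by (simp flip: sum_distrib_left)
    also have "(\<Sum>T\<in>Pow V. h T * (if T \<subseteq> U then 2 ^ (card V - card U) else 0)) =
      (\<Sum>T\<in>Pow U. h T * 2 ^ (card V - card U))"
      using U V by (intro sum.mono_neutral_cong_right) auto
    also have "\<dots> / 2 ^ card V = (\<Sum>T\<in>Pow U. h T) / 2 ^ card U"
      using card_mono[OF V U] by (simp add: power_diff sum_divide_distrib)
    finally show ?thesis .
  qed
  \<comment> \<open>With n = \<open>card V\<close>, the 2^n - 1 nonempty sets contribute at most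
    1/2^n each, so they cannot outweigh the constant coefficient 1.\<close>
  have nonneg: "0 \<le> p x" for x
  proof -
    have "(\<Sum>T\<in>Pow V - {{}}. \<bar>h T * (-1) ^ card (T - x)\<bar>) \<le> (\<Sum>T\<in>Pow V - {{}}. 1 / 2 ^ card V)"
      using small by (intro sum_mono) (auto simp: abs_mult power_abs)
    also have "\<dots> = (2 ^ card V - 1) / 2 ^ card V"
      using V by (simp add: card_Diff_subset card_Pow of_nat_diff)
    also have "\<dots> \<le> 1" by simp
    finally have "\<bar>\<Sum>T\<in>Pow V - {{}}. h T * (-1) ^ card (T - x)\<bar> \<le> 1"
      by (rule order_trans[OF sum_abs])
    moreover have "(\<Sum>T\<in>Pow V. h T * (-1) ^ card (T - x)) =
      1 + (\<Sum>T\<in>Pow V - {{}}. h T * (-1) ^ card (T - x))"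
      using V by (subst sum.remove[of _ "{}"]) (auto simp: h0)
    ultimately show ?thesis by (simp add: p_def)
  qed
  have sum1: "(\<Sum>x\<in>Pow V. p x) = 1"
    using ev[of "{}"] by (simp add: event_prob_def h0 Pow_def)
  have "p x \<le> 1" if "x \<in> Pow V" for x
    using member_le_sum[of x "Pow V" p] V nonneg that by (simp add: sum1)
  then show "finite_prob_space (Pow V) p"
    using V nonneg sum1 by (simp add: finite_prob_space_def)
qed

section \<open>The characterization\<close>

lemma betweenness_digraph_wf:
  assumes "R \<subseteq> V \<times> V \<times> V" and "betweenness V R"
  shows "pair_wf_digraph (betweenness_digraph V R)"
proof -
  have "fst e \<in> pverts (betweenness_digraph V R) \<and> snd e \<in> pverts (betweenness_digraph V R)"
    if e: "e \<in> parcs (betweenness_digraph V R)" for e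
  proof -
    from e obtain a b c where "e = ({a, b}, {a, c})" and R: "(a, b, c) \<in> R"
      by (auto simp: betweenness_digraph_def)
    moreover from R assms have "a \<in> V" "b \<in> V" "c \<in> V" "a \<noteq> b" "a \<noteq> c"
      by (auto simp: betweenness_def)
    ultimately show ?thesis by (simp add: betweenness_digraph_def)
  qed
  then show ?thesis by (simp add: pair_wf_digraph_def)
qed

section \<open>Necessity: correlation as a potential on pairs\<close>

lemma abstract_causal_betweenness_imp:
  assumes RV: "R \<subseteq> V \<times> V \<times> V" and "abstract_causal_betweenness V R"
  shows "betweenness V R" and "acyclic (parcs (betweenness_digraph V R))"
proof -
  obtain S :: "nat set" and p X where S: "finite_prob_space S p" and X: "X \<subseteq> Pow S"
    and iso: "ternary_isomorphic V R X (CB p X)"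
    using assms(2) unfolding abstract_causal_betweenness_def by (elim exE conjE)
  obtain f where f: "bij_betw f V X"
    and fR: "\<And>a b c. \<lbrakk>a \<in> V; b \<in> V; c \<in> V\<rbrakk> \<Longrightarrow> (a, b, c) \<in> R \<longleftrightarrow> (f a, f b, f c) \<in> CB p X"
    using iso unfolding ternary_isomorphic_def by blast
  have fX: "f a \<in> X" if "a \<in> V" for a using bij_betwE[OF f] that by blast
  have fS: "f a \<subseteq> S" if "a \<in> V" for a using X fX[OF that] by auto
  have R: "(a, b, c) \<in> R \<longleftrightarrow> causally_between p (f a) (f b) (f c)"
    if "a \<in> V" "b \<in> V" "c \<in> V" for a b c
    using fR[OF that] fX[OF that(1)] fX[OF that(2)] fX[OF that(3)] by (simp add: CB_def)
  show bt: "betweenness V R"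
    unfolding betweenness_def
  proof (intro ballI impI)
    fix a b c assume abc: "a \<in> V" "b \<in> V" "c \<in> V" and "(a, b, c) \<in> R"
    then have cb: "causally_between p (f a) (f b) (f c)" using R by simp
    show "(a \<noteq> b \<and> b \<noteq> c \<and> a \<noteq> c) \<and> (c, b, a) \<in> R \<and> (c, a, b) \<notin> R"
      using causally_between_betweenness[OF S _ _ _ cb] causally_between_sym[OF cb] abc
      by (auto simp: R fS)
  qed
  \<comment> \<open>Intersection and product over \<open>e\<close> make the correlation a function
    of the unordered pair, without choosing an order of its points.\<close>
  define \<phi> where "\<phi> e = event_prob p (\<Inter>a\<in>e. f a) / (\<Prod>a\<in>e. event_prob p (f a))" for e
  have \<phi>: "\<phi> {a, b} = event_corr p (f a) (f b)" if "a \<noteq> b" for a b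
    using that by (simp add: \<phi>_def event_corr_def)
  have "\<phi> y < \<phi> x" if xy: "(x, y) \<in> parcs (betweenness_digraph V R)" for x y
  proof -
    from xy obtain a b c where *: "x = {a, b}" "y = {a, c}" "(a, b, c) \<in> R"
      by (auto simp: betweenness_digraph_def)
    with RV have abc: "a \<in> V" "b \<in> V" "c \<in> V" by auto
    have "a \<noteq> b" "a \<noteq> c" using bt abc *(3) unfolding betweenness_def by blast+
    moreover have "event_corr p (f a) (f c) < event_corr p (f a) (f b)"
      using causally_between_corr_less[OF S fS fS fS] R[OF abc] *(3) abc by simp
    ultimately show ?thesis by (simp add: *(1,2) \<phi>)
  qed
  then show "acyclic (parcs (betweenness_digraph V R))" by (rule acyclic_if_decreasing)
qed

section \<open>Sufficiency: events with prescribed Walsh coefficients\<close>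

text \<open>Here x, y, z and d are the Walsh coefficients of AB, BC, AC and ABC.\<close>

lemma causally_between_Walsh_iff:
  assumes fin: "finite A" "finite B" "finite C"
    and P1: "event_prob p A = 1/2" "event_prob p B = 1/2" "event_prob p C = 1/2"
    and P2: "event_prob p (A \<inter> B) = (1 + x) / 4" "event_prob p (B \<inter> C) = (1 + y) / 4"
      "event_prob p (A \<inter> C) = (1 + z) / 4"
    and P3: "event_prob p (A \<inter> B \<inter> C) = (1 + x + y + z + d) / 8"
  shows "causally_between p A B C \<longleftrightarrow>
    0 < z \<and> z < x \<and> z < y \<and> d = x * y - z \<and> x < 1 \<and> y < 1"
proof -
  \<comment> \<open>These differences become (1 - x)/4 and (1 - y)/4, the source of the bounds
    \<open>x < 1\<close> and \<open>y < 1\<close>.\<close>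
  have diff: "event_prob p (B - A) = event_prob p B - event_prob p (A \<inter> B)"
    "event_prob p (B - C) = event_prob p B - event_prob p (B \<inter> C)"
    using fin by (simp_all add: event_prob_def sum_diff[of B "A \<inter> B", symmetric]
        sum_diff[of B "B \<inter> C", symmetric] Diff_Int)
  have sw: "C \<inter> B = B \<inter> C" "C \<inter> A = A \<inter> C" "A \<inter> C \<inter> B = A \<inter> B \<inter> C" by auto
  have "(1 + x + y + z + d) / 8 / (1/2) = (1 + x) / 4 / (1/2) * ((1 + y) / 4 / (1/2))
    \<longleftrightarrow> d = x * y - z"
    by (auto simp: field_simps)
  then show ?thesis
    unfolding causally_between_def event_cond_prob_def diff sw P1 P2 P3 by auto
qed

lemma betweenness_imp_abstract_causal_betweenness:
  assumes V: "finite V" and RV: "R \<subseteq> V \<times> V \<times> V"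
    and bt: "betweenness V R" and acyc: "acyclic (parcs (betweenness_digraph V R))"
  shows "abstract_causal_betweenness V R"
proof -
  have distinct: "a \<noteq> b" "b \<noteq> c" "a \<noteq> c" and sym: "(c, b, a) \<in> R" and asym: "(c, a, b) \<notin> R"
    if "(a, b, c) \<in> R" for a b c
    using bt RV that unfolding betweenness_def by blast+
  have arc: "({a, b}, {a, c}) \<in> parcs (betweenness_digraph V R)" if "(a, b, c) \<in> R" for a b c
    using that by (auto simp: betweenness_digraph_def)
  have "parcs (betweenness_digraph V R) \<subseteq> Pow V \<times> Pow V"
    using RV by (auto simp: betweenness_digraph_def)
  then have "finite (parcs (betweenness_digraph V R))"
    by (rule finite_subset) (use V in simp)
  then obtain r :: "'a set \<Rightarrow> real" where r: "\<And>e. 0 \<le> r e" "\<And>e. r e \<le> 1"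
    "\<And>e e'. (e, e') \<in> parcs (betweenness_digraph V R) \<Longrightarrow> r e' < r e"
    using acyclic_imp_decreasing[OF _ acyc] by metis
  \<comment> \<open>The factor 2^(-\<open>card V\<close>) makes all coefficients small enough for
    \<open>ex_prob_Walsh\<close>; the factor 1/8 gives 4\<epsilon>^2 < \<epsilon>, so products of
    two weights in [\<epsilon>, 2\<epsilon>] stay below every weight.\<close>
  define \<epsilon> :: real where "\<epsilon> = 1 / (8 * 2 ^ card V)"
  have \<epsilon>: "0 < \<epsilon>" "\<epsilon> \<le> 1/8" "2 * \<epsilon> \<le> 1 / 2 ^ card V"
    by (simp_all add: \<epsilon>_def field_simps)
  define w where "w e = \<epsilon> * (1 + r e)" for e
  have w: "\<epsilon> \<le> w e" "w e \<le> 2 * \<epsilon>" for e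
    using r(1,2)[of e] \<epsilon>(1) by (simp_all add: w_def)
  have w_pos: "0 < w e" and w_less1: "w e < 1" for e using w[of e] \<epsilon> by auto
  \<comment> \<open>The second inequality is the arc of the reversed triple.\<close>
  have w_arc: "w {a, c} < w {a, b}" "w {a, c} < w {b, c}" if "(a, b, c) \<in> R" for a b c
    using r(3)[OF arc[OF that]] r(3)[OF arc[OF sym[OF that]]] \<epsilon>(1)
    by (simp_all add: w_def insert_commute)
  have w_mult: "w e * w e' < w e''" for e e' e''
  proof -
    have "w e * w e' \<le> (2 * \<epsilon>) * (2 * \<epsilon>)"
      using w[of e] w[of e'] \<epsilon>(1) by (intro mult_mono) auto
    also have "\<dots> < \<epsilon>" using \<epsilon> by simp
    finally show ?thesis using w(1)[of e''] by simp
  qed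
  \<comment> \<open>A three-point set with its middle fixes the triple up to exchanging the ends,
    and the symmetry of \<open>R\<close> absorbs the exchange.\<close>
  have same_middle: "(a, b, c) \<in> R"
    if R: "(a', b, c') \<in> R" and eq: "{a, b, c} = {a', b, c'}" and ne: "a \<noteq> b" "b \<noteq> c" for a' b c' a c
  proof -
    have "{a, b, c} - {b} = {a', b, c'} - {b}" using eq by simp
    then have "{a, c} = {a', c'}" using ne distinct[OF R] by (simp add: insert_Diff_if)
    then show ?thesis using R sym[OF R] by (auto simp: doubleton_eq_iff)
  qed
  define mid where "mid T = {b. \<exists>a c. (a, b, c) \<in> R \<and> T = {a, b, c}}" for T
  \<comment> \<open>Another middle point would be an end of the triple; up to symmetry this is the
    configuration forbidden by the last clause of \<open>betweenness\<close>.\<close>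
  have mid: "mid {a, b, c} = {b}" if R: "(a, b, c) \<in> R" for a b c
  proof -
    have "b' = b" if R': "(a', b', c') \<in> R" and eq: "{a, b, c} = {a', b', c'}" for a' b' c'
    proof -
      have "b' \<in> {a, b, c}" unfolding eq by simp
      moreover have "b' \<noteq> a"
      proof
        assume "b' = a"
        then have "(b, a, c) \<in> R"
          using same_middle[of a' a c' b c] R' eq distinct[OF R] by (simp add: insert_commute)
        then show False using asym[OF R] sym by blast
      qed
      moreover have "b' \<noteq> c"
      proof
        assume "b' = c"
        then have "(a, c, b) \<in> R"
          using same_middle[of a' c c' a b] R' eq distinct[OF R] by (simp add: insert_commute)
        then show False using asym[OF sym[OF R]] by blast
      qed
      ultimately show ?thesis by blast
    qed
    then show ?thesis using R by (auto simp: mid_def)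
  qed
  \<comment> \<open>As mid T has at most one element, the sum selects the middle point without a choice operator.\<close>
  define d where "d T = (\<Sum>b\<in>mid T. (\<Prod>a\<in>T - {b}. w {a, b}) - w (T - {b}))" for T
  have d_mid: "d {a, b, c} = w {a, b} * w {b, c} - w {a, c}" if R: "(a, b, c) \<in> R" for a b c
  proof -
    have "{a, b, c} - {b} = {a, c}" using distinct[OF R] by auto
    then show ?thesis
      using distinct[OF R] by (simp add: d_def mid[OF R] insert_commute)
  qed
  have d_none: "d T = 0" if "mid T = {}" for T using that by (simp add: d_def)
  have d_bound: "\<bar>d T\<bar> \<le> 2 * \<epsilon>" for T
  proof (cases "mid T = {}")
    case True
    then show ?thesis using \<epsilon>(1) by (simp add: d_none)
  next
    case False
    then obtain a b c where "(a, b, c) \<in> R" "T = {a, b, c}" by (auto simp: mid_def)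
    then have "d T = w {a, b} * w {b, c} - w {a, c}" using d_mid by simp
    \<comment> \<open>The product lies strictly between 0 and \<open>w {a, c}\<close>, so
      \<open>d T\<close> lies between -2\<epsilon> and 0.\<close>
    moreover have "0 < w {a, b} * w {b, c}" using w_pos by simp
    ultimately show ?thesis using w_mult[of "{a, b}" "{b, c}" "{a, c}"] w[of "{a, c}"] by linarith
  qed
  \<comment> \<open>The value 0 on singletons gives every event probability 1/2. Conditions (1) to
    (5) involve only sets of at most three points, so larger sets get 0.\<close>
  define h where "h T = (if T = {} then 1 else if card T = 2 then w T
    else if card T = 3 then d T else 0)" for T
  have "\<bar>h T\<bar> \<le> 1 / 2 ^ card V" if "T \<noteq> {}" for T
    using that w[of T] d_bound[of T] \<epsilon> by (auto simp: h_def)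
  then obtain p where p: "finite_prob_space (Pow V) p" and
    prob: "\<And>U. U \<subseteq> V \<Longrightarrow> event_prob p {x \<in> Pow V. U \<subseteq> x} = (\<Sum>T\<in>Pow U. h T) / 2 ^ card U"
    using ex_prob_Walsh[OF V, of h] by (auto simp: h_def)
  define E where "E a = {x \<in> Pow V. {a} \<subseteq> x}" for a
  have fin: "finite (E a)" for a using V by (simp add: E_def)
  have P1: "event_prob p (E a) = 1/2" if "a \<in> V" for a
    using prob[of "{a}"] that by (simp add: E_def h_def Pow_insert)
  have P2: "event_prob p (E a \<inter> E b) = (1 + w {a, b}) / 4" if "a \<in> V" "b \<in> V" "a \<noteq> b" for a b
  proof -
    have "E a \<inter> E b = {x \<in> Pow V. {a, b} \<subseteq> x}" by (auto simp: E_def)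
    then show ?thesis using prob[of "{a, b}"] that
      by (simp add: h_def Pow_insert insert_eq_iff)
  qed
  have P3: "event_prob p (E a \<inter> E b \<inter> E c) =
      (1 + w {a, b} + w {b, c} + w {a, c} + d {a, b, c}) / 8"
    if "a \<in> V" "b \<in> V" "c \<in> V" "a \<noteq> b" "b \<noteq> c" "a \<noteq> c" for a b c
  proof -
    have "E a \<inter> E b \<inter> E c = {x \<in> Pow V. {a, b, c} \<subseteq> x}" by (auto simp: E_def)
    moreover have "Pow {a, b, c} = {{}, {a}, {b}, {c}, {a, b}, {b, c}, {a, c}, {a, b, c}}"
      by (auto simp: Pow_insert)
    moreover have "sum h {{}, {a}, {b}, {c}, {a, b}, {b, c}, {a, c}, {a, b, c}} =
      1 + w {a, b} + w {b, c} + w {a, c} + d {a, b, c}"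
    proof -
      \<comment> \<open>The subsets must be distinct, or terms of the sum would merge.\<close>
      have "{a, b} \<noteq> {b, c}" "{a, b} \<noteq> {a, c}" "{b, c} \<noteq> {a, c}"
        using that by (auto simp: doubleton_eq_iff)
      moreover have "{a, b} \<noteq> {a, b, c}" "{b, c} \<noteq> {a, b, c}" "{a, c} \<noteq> {a, b, c}"
        using that by auto
      ultimately show ?thesis using that by (simp add: h_def)
    qed
    ultimately show ?thesis using prob[of "{a, b, c}"] that by simp
  qed
  have iff: "(a, b, c) \<in> R \<longleftrightarrow> causally_between p (E a) (E b) (E c)"
    if abc: "a \<in> V" "b \<in> V" "c \<in> V" for a b c
  proof (cases "a \<noteq> b \<and> b \<noteq> c \<and> a \<noteq> c")
    case False
    have "E a \<subseteq> Pow V" for a by (auto simp: E_def)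
    then have "\<not> causally_between p (E a) (E b) (E c)"
      using False causally_between_betweenness(1-3)[OF p] by metis
    then show ?thesis using False distinct by blast
  next
    case True
    then have ne: "a \<noteq> b" "b \<noteq> c" "a \<noteq> c" "b \<noteq> a" "c \<noteq> b" by auto
    have cb: "causally_between p (E a) (E b) (E c) \<longleftrightarrow>
      w {a, c} < w {a, b} \<and> w {a, c} < w {b, c} \<and> d {a, b, c} = w {a, b} * w {b, c} - w {a, c}"
      using ne abc w_pos w_less1
        causally_between_Walsh_iff[OF fin fin fin P1 P1 P1 P2 P2 P2 P3, of a b c] by simp
    show ?thesis
    proof
      assume "(a, b, c) \<in> R"
      then show "causally_between p (E a) (E b) (E c)"
        unfolding cb using w_arc d_mid by blast
    next
      assume cbE: "causally_between p (E a) (E b) (E c)"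
      show "(a, b, c) \<in> R"
      proof (cases "mid {a, b, c} = {}")
        \<comment> \<open>With \<open>d\<close> zero, (4) would equate a product of two weights with
          a weight.\<close>
        case True
        then show ?thesis
          using cbE w_mult[of "{a, b}" "{b, c}" "{a, c}"] unfolding cb by (simp add: d_none)
      next
        case False
        then obtain a' b' c' where R': "(a', b', c') \<in> R" and eq: "{a, b, c} = {a', b', c'}"
          by (auto simp: mid_def)
        have "b' \<in> {a, b, c}" unfolding eq by simp
        \<comment> \<open>In a triple of \<open>R\<close> the pair of ends has strictly the smallest
          weight of the three pairs. By \<open>cb\<close> that pair is \<open>{a, c}\<close>, so
          neither \<open>a\<close> nor \<open>c\<close> can be the middle.\<close>
        moreover have "b' \<noteq> a"
        proof
          assume "b' = a"
          then have "(b, a, c) \<in> R"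
            using same_middle[of a' a c' b c] R' eq ne by (simp add: insert_commute)
          then show False using w_arc(1)[of b a c] w_arc(2)[of b a c] cbE unfolding cb by simp
        qed
        moreover have "b' \<noteq> c"
        proof
          assume "b' = c"
          then have "(a, c, b) \<in> R"
            using same_middle[of a' c c' a b] R' eq ne by (simp add: insert_commute)
          then show False using w_arc(1)[of a c b] cbE unfolding cb by simp
        qed
        ultimately have "b' = b" by blast
        then show ?thesis using same_middle[of a' b c' a c] R' eq ne by simp
      qed
    qed
  qed
  \<comment> \<open>The sample point \<open>{a}\<close> separates \<open>E a\<close> from every
    other event.\<close>
  have "{a} \<in> E a" "a \<noteq> b \<Longrightarrow> {a} \<notin> E b" if "a \<in> V" for a b
    using that by (auto simp: E_def)
  then have "inj_on E V" by (metis inj_onI)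
  then have iso: "ternary_isomorphic V R (E ` V) (CB p (E ` V))"
    unfolding ternary_isomorphic_def by (intro exI[of _ E]) (auto simp: bij_betw_def CB_def iff)
  have "E ` V \<subseteq> Pow (Pow V)" by (auto simp: E_def)
  \<comment> \<open>The sample points are subsets of \<open>V\<close>; this rule moves them to the
    naturals.\<close>
  then show ?thesis by (rule abstract_causal_betweennessI[OF p _ iso])
qed

theorem theorem1:
  fixes V :: "'a set" and R :: "('a \<times> 'a \<times> 'a) set"
  assumes "finite V" and "R \<subseteq> V \<times> V \<times> V"
  shows "abstract_causal_betweenness V R \<longleftrightarrow>
    betweenness V R \<and> \<not> has_directed_cycle (betweenness_digraph V R)"
proof
  assume "abstract_causal_betweenness V R"
  note imp = abstract_causal_betweenness_imp[OF assms(2) this]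
  show "betweenness V R \<and> \<not> has_directed_cycle (betweenness_digraph V R)"
    using imp has_directed_cycle_iff[OF betweenness_digraph_wf[OF assms(2) imp(1)]] by simp
next
  assume *: "betweenness V R \<and> \<not> has_directed_cycle (betweenness_digraph V R)"
  then have "acyclic (parcs (betweenness_digraph V R))"
    using has_directed_cycle_iff[OF betweenness_digraph_wf[OF assms(2)]] by simp
  with * show "abstract_causal_betweenness V R"
    using betweenness_imp_abstract_causal_betweenness[OF assms] by simp
qed

end
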